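(* Let $\underline{x}<\bar{x}$ and $\underline{y}<\bar{y}$ be real numbers, $w_x=\bar x-\underline x$, $w_y=\bar y-\underline y$. Consider the MIP relaxations HybS, Bin2 and Bin3 of $z=xy$ over $[\underline x,\bar x]\times[\underline y,\bar y]$, without the McCormick envelope constraints. Then the LP relaxation of HybS in the limit as $L,L_1\to\infty$ is strictly tighter than that of Bin2 and than that of Bin3, i.e. the limit set $\lim_{L,L_1\to\infty}\operatorname{proj}_{x,y,z}(P^{LP}_{L,L_1})$ for HybS is a proper subset of the corresponding limit set for Bin2 and a proper subset of the one for Bin3. Moreover, the volume of the projected LP relaxation of HybS in the limit as $L,L_1\to\infty$ is smaller than that of Bin2 and than that of Bin3 by $\tfrac14 w_x^2w_y^2$.
   Context: $L,L_1$ are nonnegative integers with $L\le L_1$. Limits of sets are with respect to Hausdorff distance. For $j\ge0$ put $f^j(x,\boldsymbol g)=x-\sum_{i=1}^j2^{-2i}g_i$. $Q^{L_1}$ (sawtooth epigraph relaxation) is the set of $(x,z)\in[0,1]\times\mathbb{R}$ for which there is $\boldsymbol g=(g_0,\dots,g_{L_1})\in[0,1]^{L_1+1}$ with $g_0=x$; $g_j\le2g_{j-1}$ and $g_j\le2(1-g_{j-1})$ for $j=1,\dots,L_1$; $z\ge f^j(x,\boldsymbol g)-2^{-2j-2}$ for $j=0,\dots,L_1$; $z\ge0$; $z\ge2x-1$. $R^{L,L_1}$ (tightened sawtooth relaxation) is the set of $(x,z)\in[0,1]\times\mathbb{R}$ for which there are $\boldsymbol g=(g_0,\dots,g_{L_1})\in[0,1]^{L_1+1}$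 and $\boldsymbol\alpha\in\{0,1\}^L$ with $g_0=x$; $g_j\le2g_{j-1}$ and $g_j\le2(1-g_{j-1})$ for $j=1,\dots,L_1$; $z\ge f^j(x,\boldsymbol g)-2^{-2j-2}$ for $j=0,\dots,L_1$; $z\ge0$; $z\ge2x-1$; and, in addition, $2(g_{j-1}-\alpha_j)\le g_j$ and $2(\alpha_j-g_{j-1})\le g_j$ for $j=1,\dots,L$, and $z\le f^L(x,\boldsymbol g)$. For a variable $t\in[a,b]$ with $a<b$ (general interval), "$(t,z_t)\in R^{L,L_1}$" means $(\hat t,\hat z)\in R^{L,L_1}$ with $\hat t=\frac{t-a}{b-a}$, $\hat z=\frac{z_t-a(2t-a)}{(b-a)^2}$, and similarly for $Q^{L_1}$. Each use of $R^{L,L_1}$ or $Q^{L_1}$ has its own auxiliary variables $\boldsymbol g$ (and $\boldsymbol\alpha$). MIP relaxations of $z=xy$, $x\in[\underline x,\bar x]$, $y\in[\underline y,\bar y]$, without McCormick constraints: - Bin2: $p=x+y\in[\underline x+\underline y,\bar x+\bar y]$, $z=\frac12(z_p-z_x-z_y)$, $(x,z_x),(y,z_y),(p,z_p)\in R^{L,L_1}$. - Bin3: $p=x-y\in[\underline x-\bar y,\bar x-\underline y]$, $z=\frac12(z_x+z_y-z_p)$, $(x,z_x),(y,z_y),(p,z_p)\in R^{L,L_1}$. - HybS: $p_1=x+y\in[\underline x+\underline y,\bar x+\bar y]$, $p_2=x-y\in[\underline x-\bar y,\bar x-\underline y]$, $(x,z_x),(y,z_y)\in R^{L,L_1}$,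 $(p_1,z_{p_1}),(p_2,z_{p_2})\in Q^{L_1}$, $\frac12(z_{p_1}-z_x-z_y)\le z\le\frac12(z_x+z_y-z_{p_2})$. $P^{LP}_{L,L_1}$ denotes the LP relaxation of the respective formulation (in the space of all variables), obtained by relaxing every binary variable $\alpha_j$ to $[0,1]$; $\operatorname{proj}_{x,y,z}$ is the projection onto $(x,y,z)$. *)

theory Defs
  imports "HOL-Analysis.Analysis"
begin

definition saw_f :: "nat \<Rightarrow> real \<Rightarrow> (nat \<Rightarrow> real) \<Rightarrow> real" where
  "saw_f j x g = x - (\<Sum>i = 1..j. g i / 2 ^ (2 * i))"

text \<open>Constraints of \<open>Q\<close> on the unit interval, with the auxiliary vector \<open>g = (g\<^sub>0, \<dots>, g\<^sub>L\<^sub>1)\<close>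
  kept explicit. Vectors are extensional functions on their index set.\<close>

definition sawtooth_epi :: "nat \<Rightarrow> real \<Rightarrow> real \<Rightarrow> (nat \<Rightarrow> real) \<Rightarrow> bool" where
  "sawtooth_epi L1 x z g \<longleftrightarrow>
     x \<in> {0..1} \<and> g \<in> {0..L1} \<rightarrow>\<^sub>E {0..1} \<and> g 0 = x \<and>
     (\<forall>j\<in>{1..L1}. g j \<le> 2 * g (j - 1) \<and> g j \<le> 2 * (1 - g (j - 1))) \<and>
     (\<forall>j\<in>{0..L1}. z \<ge> saw_f j x g - 1 / 2 ^ (2 * j + 2)) \<and>
     z \<ge> 0 \<and> z \<ge> 2 * x - 1"

text \<open>Constraints of \<open>R\<close> on the unit interval. The parameter \<open>B\<close> is the domain of the variables
  \<open>\<alpha>\<^sub>1, \<dots>, \<alpha>\<^sub>L\<close>: here and below, \<open>B = {0, 1}\<close> gives the mixed-integer formulation and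
  \<open>B = {0..1}\<close> its LP relaxation.\<close>

definition sawtooth_tight ::
  "real set \<Rightarrow> nat \<Rightarrow> nat \<Rightarrow> real \<Rightarrow> real \<Rightarrow> (nat \<Rightarrow> real) \<Rightarrow> (nat \<Rightarrow> real) \<Rightarrow> bool" where
  "sawtooth_tight B L L1 x z g \<alpha> \<longleftrightarrow>
     sawtooth_epi L1 x z g \<and> \<alpha> \<in> {1..L} \<rightarrow>\<^sub>E B \<and>
     (\<forall>j\<in>{1..L}. 2 * (g (j - 1) - \<alpha> j) \<le> g j \<and> 2 * (\<alpha> j - g (j - 1)) \<le> g j) \<and>
     z \<le> saw_f L x g"

text \<open>Transfer to a variable \<open>t \<in> [a, b]\<close>: affine rescaling of \<open>t\<close> to \<open>[0, 1]\<close>, under which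
  \<open>z = t\<^sup>2\<close> corresponds to equality of the rescaled \<open>z\<close> with the square of the rescaled \<open>t\<close>.\<close>

definition scale_t :: "real \<Rightarrow> real \<Rightarrow> real \<Rightarrow> real" where
  "scale_t a b t = (t - a) / (b - a)"

definition scale_z :: "real \<Rightarrow> real \<Rightarrow> real \<Rightarrow> real \<Rightarrow> real" where
  "scale_z a b t z = (z - a * (2 * t - a)) / (b - a)\<^sup>2"

lemma scale_z_square: "a < b \<Longrightarrow> scale_z a b t (t\<^sup>2) = (scale_t a b t)\<^sup>2"
  by (simp add: scale_z_def scale_t_def power_divide power2_eq_square algebra_simps)

definition Q_on :: "real \<Rightarrow> real \<Rightarrow> nat \<Rightarrow> real \<Rightarrow> real \<Rightarrow> (nat \<Rightarrow> real) \<Rightarrow> bool" where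
  "Q_on a b L1 t z g \<longleftrightarrow> sawtooth_epi L1 (scale_t a b t) (scale_z a b t z) g"

definition R_on :: "real set \<Rightarrow> real \<Rightarrow> real \<Rightarrow> nat \<Rightarrow> nat \<Rightarrow>
    real \<Rightarrow> real \<Rightarrow> (nat \<Rightarrow> real) \<Rightarrow> (nat \<Rightarrow> real) \<Rightarrow> bool" where
  "R_on B a b L L1 t z g \<alpha> \<longleftrightarrow> sawtooth_tight B L L1 (scale_t a b t) (scale_z a b t z) g \<alpha>"

type_synonym point = "real \<times> real \<times> real"
type_synonym vec = "nat \<Rightarrow> real"

text \<open>The formulations in the space of all variables. The first component is \<open>(x, y, z)\<close>, the
  second collects all auxiliary variables, so that \<^const>\<open>fst\<close> is the projection onto \<open>(x, y, z)\<close>.\<close>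

definition bin2 :: "real set \<Rightarrow> real \<Rightarrow> real \<Rightarrow> real \<Rightarrow> real \<Rightarrow> nat \<Rightarrow> nat \<Rightarrow>
    (point \<times> (real \<times> real \<times> real \<times> real) \<times> (vec \<times> vec) \<times> (vec \<times> vec) \<times> (vec \<times> vec)) set" where
  "bin2 B xl xu yl yu L L1 =
     {((x, y, z), (p, zx, zy, zp), (gx, \<alpha>x), (gy, \<alpha>y), (gp, \<alpha>p))
      | x y z p zx zy zp gx \<alpha>x gy \<alpha>y gp \<alpha>p.
        x \<in> {xl..xu} \<and> y \<in> {yl..yu} \<and>
        p = x + y \<and> p \<in> {xl + yl..xu + yu} \<and>
        z = (zp - zx - zy) / 2 \<and>
        R_on B xl xu L L1 x zx gx \<alpha>x \<and>
        R_on B yl yu L L1 y zy gy \<alpha>y \<and>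
        R_on B (xl + yl) (xu + yu) L L1 p zp gp \<alpha>p}"

definition bin3 :: "real set \<Rightarrow> real \<Rightarrow> real \<Rightarrow> real \<Rightarrow> real \<Rightarrow> nat \<Rightarrow> nat \<Rightarrow>
    (point \<times> (real \<times> real \<times> real \<times> real) \<times> (vec \<times> vec) \<times> (vec \<times> vec) \<times> (vec \<times> vec)) set" where
  "bin3 B xl xu yl yu L L1 =
     {((x, y, z), (p, zx, zy, zp), (gx, \<alpha>x), (gy, \<alpha>y), (gp, \<alpha>p))
      | x y z p zx zy zp gx \<alpha>x gy \<alpha>y gp \<alpha>p.
        x \<in> {xl..xu} \<and> y \<in> {yl..yu} \<and>
        p = x - y \<and> p \<in> {xl - yu..xu - yl} \<and>
        z = (zx + zy - zp) / 2 \<and>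
        R_on B xl xu L L1 x zx gx \<alpha>x \<and>
        R_on B yl yu L L1 y zy gy \<alpha>y \<and>
        R_on B (xl - yu) (xu - yl) L L1 p zp gp \<alpha>p}"

definition hybs :: "real set \<Rightarrow> real \<Rightarrow> real \<Rightarrow> real \<Rightarrow> real \<Rightarrow> nat \<Rightarrow> nat \<Rightarrow>
    (point \<times> (real \<times> real \<times> real \<times> real \<times> real \<times> real) \<times> (vec \<times> vec) \<times> (vec \<times> vec) \<times> vec \<times> vec) set" where
  "hybs B xl xu yl yu L L1 =
     {((x, y, z), (p1, p2, zx, zy, zp1, zp2), (gx, \<alpha>x), (gy, \<alpha>y), gp1, gp2)
      | x y z p1 p2 zx zy zp1 zp2 gx \<alpha>x gy \<alpha>y gp1 gp2.
        x \<in> {xl..xu} \<and> y \<in> {yl..yu} \<and>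
        p1 = x + y \<and> p1 \<in> {xl + yl..xu + yu} \<and>
        p2 = x - y \<and> p2 \<in> {xl - yu..xu - yl} \<and>
        R_on B xl xu L L1 x zx gx \<alpha>x \<and>
        R_on B yl yu L L1 y zy gy \<alpha>y \<and>
        Q_on (xl + yl) (xu + yu) L1 p1 zp1 gp1 \<and>
        Q_on (xl - yu) (xu - yl) L1 p2 zp2 gp2 \<and>
        (zp1 - zx - zy) / 2 \<le> z \<and> z \<le> (zx + zy - zp2) / 2}"

definition bin2_lp_proj :: "real \<Rightarrow> real \<Rightarrow> real \<Rightarrow> real \<Rightarrow> nat \<Rightarrow> nat \<Rightarrow> point set" where
  "bin2_lp_proj xl xu yl yu L L1 = fst ` bin2 {0..1} xl xu yl yu L L1"

definition bin3_lp_proj :: "real \<Rightarrow> real \<Rightarrow> real \<Rightarrow> real \<Rightarrow> nat \<Rightarrow> nat \<Rightarrow> point set" where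
  "bin3_lp_proj xl xu yl yu L L1 = fst ` bin3 {0..1} xl xu yl yu L L1"

definition hybs_lp_proj :: "real \<Rightarrow> real \<Rightarrow> real \<Rightarrow> real \<Rightarrow> nat \<Rightarrow> nat \<Rightarrow> point set" where
  "hybs_lp_proj xl xu yl yu L L1 = fst ` hybs {0..1} xl xu yl yu L L1"

text \<open>Hausdorff distance, with values in \<^typ>\<open>ennreal\<close> so that it is meaningful for arbitrary sets
  (a nonempty set is at distance \<open>\<infinity>\<close> from the empty set).\<close>

definition hausdorff_dist :: "'a::metric_space set \<Rightarrow> 'a set \<Rightarrow> ennreal" where
  "hausdorff_dist S T =
     max (SUP x\<in>S. INF y\<in>T. ennreal (dist x y)) (SUP y\<in>T. INF x\<in>S. ennreal (dist x y))"

text \<open>The limit of \<open>F L L1\<close> as \<open>L, L1 \<rightarrow> \<infinity>\<close> along pairs with \<open>L \<le> L1\<close>. Since the Hausdorff distance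
  does not distinguish a set from its closure, the limit is taken to be closed, which makes it
  unique.\<close>

definition level_filter :: "(nat \<times> nat) filter" where
  "level_filter = inf (sequentially \<times>\<^sub>F sequentially) (principal {(L, L1). L \<le> L1})"

definition hausdorff_limit :: "(nat \<Rightarrow> nat \<Rightarrow> 'a::metric_space set) \<Rightarrow> 'a set \<Rightarrow> bool" where
  "hausdorff_limit F S \<longleftrightarrow>
     closed S \<and> ((\<lambda>(L, L1). hausdorff_dist (F L L1) S) \<longlongrightarrow> 0) level_filter"

lemma level_filter_nontrivial: "level_filter \<noteq> bot"
proof
  assume "level_filter = bot"
  then have "eventually (\<lambda>_. False) level_filter" by simp
  then have "eventually (\<lambda>(L, L1). \<not> L \<le> L1) (sequentially \<times>\<^sub>F sequentially)"
    by (auto simp: level_filter_def eventually_inf_principal split_def)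
  then obtain N where "\<forall>L\<ge>N. \<forall>L1\<ge>N. \<not> L \<le> (L1::nat)"
    by (auto simp: eventually_prod_sequentially)
  then show False by blast
qed

lemma hausdorff_dist_less:
  assumes "hausdorff_dist S T < ennreal e"
  shows "x \<in> S \<Longrightarrow> \<exists>y\<in>T. dist x y < e" and "y \<in> T \<Longrightarrow> \<exists>x\<in>S. dist x y < e"
proof -
  have 1: "(SUP x\<in>S. INF y\<in>T. ennreal (dist x y)) < ennreal e"
    and 2: "(SUP y\<in>T. INF x\<in>S. ennreal (dist x y)) < ennreal e"
    using assms by (auto simp: hausdorff_dist_def)
  show "\<exists>y\<in>T. dist x y < e" if "x \<in> S"
    using le_less_trans[OF SUP_upper[OF that] 1] by (auto simp: INF_less_iff ennreal_less_iff)
  show "\<exists>x\<in>S. dist x y < e" if "y \<in> T"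
    using le_less_trans[OF SUP_upper[OF that] 2] by (auto simp: INF_less_iff ennreal_less_iff)
qed

lemma hausdorff_limit_unique:
  assumes "hausdorff_limit F S" "hausdorff_limit F T"
  shows "S = T"
proof -
  have sub: "S \<subseteq> T" if S: "hausdorff_limit F S" and T: "hausdorff_limit F T" for S T
  proof
    fix x assume x: "x \<in> S"
    have "\<exists>y\<in>T. dist y x < e" if "e > 0" for e
    proof -
      have ev: "eventually (\<lambda>(L, L1). hausdorff_dist (F L L1) U < ennreal (e / 2)) level_filter"
        if "hausdorff_limit F U" for U
        using that \<open>e > 0\<close> order_tendstoD(2)[of _ 0 level_filter "ennreal (e / 2)"]
        by (fastforce simp: hausdorff_limit_def split_def)
      have "eventually (\<lambda>(L, L1). hausdorff_dist (F L L1) S < ennreal (e / 2) \<and>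
              hausdorff_dist (F L L1) T < ennreal (e / 2)) level_filter"
        using eventually_conj[OF ev[OF S] ev[OF T]] by (simp add: split_def)
      then obtain L L1 where d: "hausdorff_dist (F L L1) S < ennreal (e / 2)"
          "hausdorff_dist (F L L1) T < ennreal (e / 2)"
        using eventually_happens'[OF level_filter_nontrivial] by fastforce
      obtain u where u: "u \<in> F L L1" "dist u x < e / 2"
        using hausdorff_dist_less(2)[OF d(1) x] by blast
      obtain y where "y \<in> T" "dist u y < e / 2"
        using hausdorff_dist_less(1)[OF d(2) u(1)] by blast
      with u show ?thesis
        by (meson dist_commute_lessI dist_triangle_half_l)
    qed
    then have "x \<in> closure T" by (simp add: closure_approachable)
    with T show "x \<in> T" by (simp add: hausdorff_limit_def)
  qed
  show ?thesis using sub assms by blast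
qed

end

theory Submission
  imports Defs
begin

text \<open>Every feasible vector satisfies \<open>x\<^sup>2 \<le> f\<^sup>j(x, g)\<close>, and the iterates of the tent map satisfy
  \<open>f\<^sup>j(x, g) \<le> x\<^sup>2 + 2\<^sup>-\<^sup>2\<^sup>j\<^sup>-\<^sup>2\<close>. Once the binaries are relaxed, \<open>\<alpha>\<^sub>j = g\<^sub>j\<^sub>-\<^sub>1\<close> makes the constraints on
  \<open>\<alpha>\<close> vacuous. Hence in the limit \<open>R\<close> becomes the region between the parabola and its secant, \<open>Q\<close>
  the epigraph of the parabola. With \<open>u, u'\<close> and \<open>v, v'\<close> the distances of \<open>x\<close> and \<open>y\<close> to the lower
  and upper end of their intervals, the secant exceeds the parabola by \<open>uu'\<close> in \<open>x\<close>, \<open>vv'\<close> in \<open>y\<close>,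
  \<open>(u + v)(u' + v')\<close> in \<open>x + y\<close> and \<open>(u + v')(u' + v)\<close> in \<open>x - y\<close>. The limit sets therefore lie
  between the graphs of \<open>xy - a\<close> and \<open>xy + b\<close>, where \<open>a = b = (uu' + vv') / 2\<close> for HybS; for Bin2 the
  bound \<open>b\<close> grows by \<open>(uv' + u'v) / 2\<close> and for Bin3 the bound \<open>a\<close> grows by \<open>(uv + u'v') / 2\<close>. Both
  increments integrate to \<open>w\<^sub>x\<^sup>2 w\<^sub>y\<^sup>2 / 4\<close>.\<close>

subsection \<open>The sawtooth relaxations\<close>

lemma saw_f_Suc: "saw_f (Suc j) x g = saw_f j x g - g (Suc j) / 2 ^ (2 * Suc j)"
  by (simp add: saw_f_def)

text \<open>The left side is the value of t - t^2 at h / 2. That function is symmetric about 1/2 and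
  increasing to the left of it, and h / 2 lies below 1/2, t and 1 - t. The factorizations in the two
  cases make this algebraic.\<close>

lemma parabola_halving_le:
  fixes h t :: real
  assumes "h \<le> 1" "h \<le> 2 * t" "h \<le> 2 * (1 - t)"
  shows "(2 * h - h\<^sup>2) / 4 \<le> t - t\<^sup>2"
proof (cases "t \<le> 1 / 2")
  case True
  then have "0 \<le> (2 * t - h) * (2 - 2 * t - h)"
    using assms by (intro mult_nonneg_nonneg) auto
  then show ?thesis by (simp add: power2_eq_square field_simps)
next
  case False
  then have "0 \<le> (2 * (1 - t) - h) * (2 - 2 * (1 - t) - h)"
    using assms by (intro mult_nonneg_nonneg) auto
  then show ?thesis by (simp add: power2_eq_square field_simps)
qed

text \<open>The remainder (g_j - g_j^2) / 4^j makes the induction close: by the halving inequality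
  it is at least (2h - h^2) / 4^(j+1) with h = g_(j+1), and passing to level j + 1 subtracts h /
  4^(j+1), leaving (h - h^2) / 4^(j+1).\<close>

lemma saw_f_ge_parabola:
  assumes "sawtooth_epi L1 x z g" "j \<le> L1"
  shows "x\<^sup>2 + (g j - (g j)\<^sup>2) / 2 ^ (2 * j) \<le> saw_f j x g"
  using assms(2)
proof (induction j)
  case 0
  then show ?case using assms(1) by (simp add: sawtooth_epi_def saw_f_def)
next
  case (Suc j)
  have "g (Suc j) \<in> {0..1}" "\<forall>j\<in>{1..L1}. g j \<le> 2 * g (j - 1) \<and> g j \<le> 2 * (1 - g (j - 1))"
    using assms(1) Suc.prems by (auto simp: sawtooth_epi_def PiE_def Pi_def)
  moreover from this(2) have "g (Suc j) \<le> 2 * g j" "g (Suc j) \<le> 2 * (1 - g j)"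
    using Suc.prems by (force dest: bspec[of _ _ "Suc j"])+
  ultimately have "(2 * g (Suc j) - (g (Suc j))\<^sup>2) / 4 \<le> g j - (g j)\<^sup>2"
    by (intro parabola_halving_le) auto
  then have "(2 * g (Suc j) - (g (Suc j))\<^sup>2) / 4 / 2 ^ (2 * j) \<le> (g j - (g j)\<^sup>2) / 2 ^ (2 * j)"
    by (rule divide_right_mono) simp
  with Suc show ?case
    by (simp add: saw_f_Suc diff_divide_distrib)
qed

text \<open>The largest successor of t that the two linear constraints permit. For it the halving
  inequality is an equality, so the remainder formula is exact along its iterates.\<close>

definition tent :: "real \<Rightarrow> real" where
  "tent t = min (2 * t) (2 * (1 - t))"

lemma tent_unit: "t \<in> {0..1} \<Longrightarrow> tent t \<in> {0..1}"
  by (auto simp: tent_def)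

lemma tent_iter_unit: "x \<in> {0..1} \<Longrightarrow> (tent ^^ j) x \<in> {0..1}"
  by (induction j) (use tent_unit in auto)

lemma parabola_halving_tent: "(2 * tent t - (tent t)\<^sup>2) / 4 = t - t\<^sup>2"
  by (simp add: tent_def min_def power2_eq_square field_simps)

lemma saw_f_tent:
  "saw_f j x (\<lambda>i. (tent ^^ i) x) = x\<^sup>2 + ((tent ^^ j) x - ((tent ^^ j) x)\<^sup>2) / 2 ^ (2 * j)"
proof (induction j)
  case 0
  show ?case by (simp add: saw_f_def)
next
  case (Suc j)
  show ?case
    unfolding saw_f_Suc Suc
    by (simp add: parabola_halving_tent[of "(tent ^^ j) x", symmetric] diff_divide_distrib)
qed

text \<open>The remainder t - t^2 lies between 0 and 1/4 on the unit interval; the value 1/4 is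
  exactly the tolerance allowed by the lower constraints on z.\<close>

lemma saw_f_tent_bounds:
  assumes "x \<in> {0..1}"
  shows "x\<^sup>2 \<le> saw_f j x (\<lambda>i. (tent ^^ i) x)"
    and "saw_f j x (\<lambda>i. (tent ^^ i) x) \<le> x\<^sup>2 + 1 / 2 ^ (2 * j + 2)"
proof -
  define t where "t = (tent ^^ j) x"
  have "t \<in> {0..1}" using tent_iter_unit[OF assms] by (simp add: t_def)
  then have "0 \<le> t - t\<^sup>2" by (simp add: power2_eq_square mult_left_le)
  then show "x\<^sup>2 \<le> saw_f j x (\<lambda>i. (tent ^^ i) x)"
    by (simp add: saw_f_tent flip: t_def)
  have "0 \<le> (t - 1 / 2)\<^sup>2" by simp
  then have "t - t\<^sup>2 \<le> 1 / 4" by (simp add: power2_eq_square algebra_simps)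
  then have "(t - t\<^sup>2) / 2 ^ (2 * j) \<le> 1 / 4 / 2 ^ (2 * j)"
    by (rule divide_right_mono) simp
  then show "saw_f j x (\<lambda>i. (tent ^^ i) x) \<le> x\<^sup>2 + 1 / 2 ^ (2 * j + 2)"
    by (simp add: saw_f_tent flip: t_def)
qed

text \<open>The tent iterates attain \<open>z = x\<^sup>2\<close> and the zero vector attains \<open>z = x\<close>; the feasible vectors in
  between are their convex combinations, with weight \<open>c\<close> on the tent iterates.\<close>

definition saw_witness :: "real \<Rightarrow> nat \<Rightarrow> real \<Rightarrow> nat \<Rightarrow> real" where
  "saw_witness c L1 x =
     restrict (\<lambda>i. if i = 0 then x else c * (tent ^^ i) x) {0..L1}"

lemma saw_f_witness:
  assumes "j \<le> L1"
  shows "saw_f j x (saw_witness c L1 x) = x - c * (x - saw_f j x (\<lambda>i. (tent ^^ i) x))"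
  using assms by (simp add: saw_f_def saw_witness_def sum_distrib_left)

lemma sawtooth_epi_witness:
  assumes x: "x \<in> {0..1}" and c: "c \<in> {0..1}" and z: "x - c * (x - x\<^sup>2) \<le> z"
  shows "sawtooth_epi L1 x z (saw_witness c L1 x)"
proof -
  let ?g = "saw_witness c L1 x"
  have unit: "(tent ^^ i) x \<in> {0..1}" for i by (rule tent_iter_unit[OF x])
  have xx: "0 \<le> x - x\<^sup>2" using x by (simp add: power2_eq_square mult_left_le)
  have "c * (x - x\<^sup>2) \<le> x - x\<^sup>2" using c xx by (simp add: mult_left_le_one_le)
  with z have z2: "x\<^sup>2 \<le> z" by simp
  have sq: "0 \<le> (x - 1)\<^sup>2" by simp
  have rng: "?g \<in> {0..L1} \<rightarrow>\<^sub>E {0..1}"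
    unfolding saw_witness_def using x c unit by (auto intro!: mult_le_one)
  have step: "?g j \<le> 2 * ?g (j - 1) \<and> ?g j \<le> 2 * (1 - ?g (j - 1))" if j: "j \<in> {1..L1}" for j
  proof -
    obtain i where i: "j = Suc i" using j by (cases j) auto
    let ?t = "(tent ^^ i) x"
    have t: "?t \<in> {0..1}" by (rule unit)
    have "tent ?t \<le> 2 * ?t" "tent ?t \<le> 2 * (1 - ?t)" by (simp_all add: tent_def)
    then have 1: "c * tent ?t \<le> c * (2 * ?t)" "c * tent ?t \<le> c * (2 * (1 - ?t))"
      using c by (auto intro!: mult_left_mono)
    \<comment> \<open>Needed at \<open>i = 0\<close>, where the preceding entry is \<open>x\<close>
      and not \<open>c * x\<close>, so the factor c has to be dropped. For positive \<open>i\<close>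
      the bounds 1 and 3 serve instead.\<close>
    have 2: "c * (2 * ?t) \<le> 2 * ?t" "c * (2 * (1 - ?t)) \<le> 2 * (1 - ?t)"
      using c t by (auto intro!: mult_left_le_one_le)
    have 3: "c * (2 * (1 - ?t)) \<le> 2 * (1 - c * ?t)" using c by (simp add: algebra_simps)
    show ?thesis
      using j 1 2 3 by (auto simp: i saw_witness_def)
  qed
  \<comment> \<open>Scaling by \<open>c\<close> also shrinks the excess of f^j over the parabola, so
    the tolerance for the tent iterates still suffices.\<close>
  have lower: "saw_f j x ?g - 1 / 2 ^ (2 * j + 2) \<le> z" if "j \<in> {0..L1}" for j
  proof -
    define s where "s = saw_f j x (\<lambda>i. (tent ^^ i) x)"
    have "c * (s - x\<^sup>2) \<le> s - x\<^sup>2"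
      using c saw_f_tent_bounds(1)[OF x, of j] by (simp add: mult_left_le_one_le s_def)
    also have "\<dots> \<le> 1 / 2 ^ (2 * j + 2)"
      using saw_f_tent_bounds(2)[OF x, of j] by (simp add: s_def)
    finally have "x - c * (x - s) - 1 / 2 ^ (2 * j + 2) \<le> x - c * (x - x\<^sup>2)"
      by (simp add: algebra_simps)
    with z that show ?thesis by (simp add: saw_f_witness flip: s_def)
  qed
  have "0 \<le> z" using z2 zero_le_power2[of x] by linarith
  moreover have "2 * x - 1 \<le> z" using z2 sq by (simp add: power2_eq_square algebra_simps)
  moreover have "?g 0 = x" by (simp add: saw_witness_def)
  ultimately show ?thesis
    unfolding sawtooth_epi_def using x rng step lower by blast
qed

lemma sawtooth_tight_lp_exists:
  assumes "L \<le> L1" "x \<in> {0..1}" "x\<^sup>2 \<le> z" "z \<le> x"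
  shows "\<exists>g \<alpha>. sawtooth_tight {0..1} L L1 x z g \<alpha>"
proof -
  have xx: "0 \<le> x - x\<^sup>2" using assms by simp
  \<comment> \<open>\<open>c\<close> is the position of z between \<open>x\<close> (at c = 0) and
    \<open>x\<^sup>2\<close> (at c = 1). At the endpoints of [0,1] these coincide and 0 is
    chosen.\<close>
  obtain c where c: "c \<in> {0..1}" "z = x - c * (x - x\<^sup>2)"
  proof (cases "x = x\<^sup>2")
    case True
    then show ?thesis using that[of 0] assms by simp
  next
    case False
    then show ?thesis using that[of "(x - z) / (x - x\<^sup>2)"] assms xx by simp
  qed
  define g where "g = saw_witness c L1 x"
  define \<alpha> where "\<alpha> = restrict (\<lambda>j. g (j - 1)) {1..L}"
  have epi: "sawtooth_epi L1 x z g"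
    unfolding g_def using sawtooth_epi_witness assms(2) c by simp
  then have rng: "g j \<in> {0..1}" if "j \<le> L1" for j
    using that by (auto simp: sawtooth_epi_def PiE_def Pi_def)
  have "\<alpha> \<in> {1..L} \<rightarrow>\<^sub>E {0..1}"
    unfolding \<alpha>_def restrict_PiE_iff using rng assms(1) by auto
  moreover have "2 * (g (j - 1) - \<alpha> j) \<le> g j \<and> 2 * (\<alpha> j - g (j - 1)) \<le> g j" if "j \<in> {1..L}" for j
    using that rng[of j] assms(1) by (simp add: \<alpha>_def)
  \<comment> \<open>In the formula for z, passing to f^L replaces x^2 by the value of f^L at the
    tent iterates, which is no smaller.\<close>
  moreover have "z \<le> saw_f L x g"
  proof -
    have "c * x\<^sup>2 \<le> c * saw_f L x (\<lambda>i. (tent ^^ i) x)"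
      using saw_f_tent_bounds(1)[OF assms(2)] c(1) by (intro mult_left_mono) auto
    then show ?thesis
      using assms(1) by (simp add: g_def saw_f_witness c(2) algebra_simps)
  qed
  ultimately show ?thesis using epi unfolding sawtooth_tight_def by blast
qed

lemma sawtooth_epi_lower:
  assumes "sawtooth_epi L1 x z g"
  shows "x\<^sup>2 - 1 / 2 ^ (2 * L1 + 2) \<le> z"
proof -
  have "g L1 \<in> {0..1}" using assms by (auto simp: sawtooth_epi_def PiE_def Pi_def)
  then have "0 \<le> (g L1 - (g L1)\<^sup>2) / 2 ^ (2 * L1)"
    by (simp add: power2_eq_square mult_left_le)
  with saw_f_ge_parabola[OF assms order_refl] have "x\<^sup>2 \<le> saw_f L1 x g" by linarith
  moreover have "saw_f L1 x g - 1 / 2 ^ (2 * L1 + 2) \<le> z"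
    using assms unfolding sawtooth_epi_def by (meson atLeastAtMost_iff order_refl zero_le)
  ultimately show ?thesis by linarith
qed

text \<open>f^L arises from x by subtracting multiples of entries g_i, which are nonnegative because
  L \<le> L1 keeps their indices in range.\<close>

lemma sawtooth_tight_upper:
  assumes "sawtooth_tight B L L1 x z g \<alpha>" "L \<le> L1"
  shows "z \<le> x"
proof -
  have "0 \<le> g i" if "i \<le> L1" for i
    using assms(1) that by (auto simp: sawtooth_tight_def sawtooth_epi_def PiE_def Pi_def)
  then have "0 \<le> (\<Sum>i = 1..L. g i / 2 ^ (2 * i))"
    using assms(2) by (intro sum_nonneg) auto
  then show ?thesis using assms(1) by (simp add: sawtooth_tight_def saw_f_def)
qed

section \<open>Transfer to a general interval\<close>

lemma scale_t_unit: "a < b \<Longrightarrow> t \<in> {a..b} \<Longrightarrow> scale_t a b t \<in> {0..1}"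
  by (simp add: scale_t_def)

lemma scale_z_minus_square:
  assumes "a < b"
  shows "scale_z a b t z - (scale_t a b t)\<^sup>2 = (z - t\<^sup>2) / (b - a)\<^sup>2"
  using assms by (simp add: scale_z_square[symmetric] scale_z_def diff_divide_distrib[symmetric])

text \<open>The unit secant z = x is carried to the secant of the parabola through a and b, which is
  (a + b) t - a b.\<close>

lemma scale_t_minus_scale_z:
  assumes "a < b"
  shows "scale_t a b t - scale_z a b t z = ((a + b) * t - a * b - z) / (b - a)\<^sup>2"
proof -
  have "scale_t a b t = (t - a) * (b - a) / (b - a)\<^sup>2"
    using assms by (simp add: scale_t_def power2_eq_square)
  then show ?thesis
    unfolding scale_z_def by (simp add: diff_divide_distrib[symmetric] algebra_simps power2_eq_square)
qed

lemma R_on_lp_exists: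
  assumes "a < b" "L \<le> L1" "t \<in> {a..b}" "t\<^sup>2 \<le> z" "z \<le> (a + b) * t - a * b"
  shows "\<exists>g \<alpha>. R_on {0..1} a b L L1 t z g \<alpha>"
  unfolding R_on_def
proof (rule sawtooth_tight_lp_exists)
  have "0 \<le> scale_z a b t z - (scale_t a b t)\<^sup>2" "0 \<le> scale_t a b t - scale_z a b t z"
    using assms unfolding scale_z_minus_square[OF assms(1)] scale_t_minus_scale_z[OF assms(1)] by simp_all
  then show "(scale_t a b t)\<^sup>2 \<le> scale_z a b t z" "scale_z a b t z \<le> scale_t a b t" by simp_all
qed (use assms scale_t_unit in auto)

lemma Q_on_exists:
  assumes "a < b" "t \<in> {a..b}" "t\<^sup>2 \<le> z"
  shows "\<exists>g. Q_on a b L1 t z g"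
proof -
  have "0 \<le> scale_z a b t z - (scale_t a b t)\<^sup>2"
    using assms unfolding scale_z_minus_square[OF assms(1)] by simp
  then have "sawtooth_epi L1 (scale_t a b t) (scale_z a b t z) (saw_witness 1 L1 (scale_t a b t))"
    using assms scale_t_unit by (intro sawtooth_epi_witness) auto
  then show ?thesis by (auto simp: Q_on_def)
qed

lemma Q_on_lower:
  assumes "a < b" "Q_on a b L1 t z g"
  shows "t\<^sup>2 - (b - a)\<^sup>2 / 2 ^ (2 * L1 + 2) \<le> z"
proof -
  have "- 1 / 2 ^ (2 * L1 + 2) \<le> (z - t\<^sup>2) / (b - a)\<^sup>2"
    using sawtooth_epi_lower[OF assms(2)[unfolded Q_on_def]]
    unfolding scale_z_minus_square[OF assms(1), symmetric] by simp
  then have "- 1 / 2 ^ (2 * L1 + 2) * (b - a)\<^sup>2 \<le> z - t\<^sup>2"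
    using assms(1) by (subst (asm) pos_le_divide_eq) auto
  then show ?thesis by simp
qed

lemma R_on_lower:
  assumes "a < b" "R_on B a b L L1 t z g \<alpha>"
  shows "t\<^sup>2 - (b - a)\<^sup>2 / 2 ^ (2 * L1 + 2) \<le> z"
  using assms Q_on_lower by (auto simp: R_on_def Q_on_def sawtooth_tight_def)

lemma R_on_upper:
  assumes "a < b" "L \<le> L1" "R_on B a b L L1 t z g \<alpha>"
  shows "z \<le> (a + b) * t - a * b"
proof -
  have "0 \<le> ((a + b) * t - a * b - z) / (b - a)\<^sup>2"
    using sawtooth_tight_upper[OF assms(3)[unfolded R_on_def] assms(2)]
    unfolding scale_t_minus_scale_z[OF assms(1), symmetric] by simp
  then show ?thesis using assms(1) by (simp add: zero_le_divide_iff)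
qed

subsection \<open>Regions between two graphs\<close>

definition slab ::
  "real set \<Rightarrow> real set \<Rightarrow> (real \<Rightarrow> real \<Rightarrow> real) \<Rightarrow> (real \<Rightarrow> real \<Rightarrow> real) \<Rightarrow> point set" where
  "slab A B l u = {(x, y, z). x \<in> A \<and> y \<in> B \<and> l x y \<le> z \<and> z \<le> u x y}"

lemma closed_slab:
  assumes "closed A" "closed B"
    and "continuous_on UNIV (\<lambda>(x, y). l x y)" "continuous_on UNIV (\<lambda>(x, y). u x y)"
  shows "closed (slab A B l u)"
proof -
  have "continuous_on UNIV (\<lambda>p::point. (\<lambda>(x, y). l x y) (fst p, fst (snd p)))"
    "continuous_on UNIV (\<lambda>p::point. (\<lambda>(x, y). u x y) (fst p, fst (snd p)))"
    by (intro continuous_on_compose2[OF assms(3)] continuous_on_compose2[OF assms(4)]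
        continuous_intros; simp)+
  moreover have "slab A B l u = (fst -` A) \<inter> ((\<lambda>p. fst (snd p)) -` B) \<inter>
      {p. l (fst p) (fst (snd p)) \<le> snd (snd p)} \<inter> {p. snd (snd p) \<le> u (fst p) (fst (snd p))}"
    by (auto simp: slab_def)
  ultimately show ?thesis
    using assms(1,2) by (auto intro!: closed_Int closed_vimage closed_Collect_le continuous_intros)
qed

text \<open>Points of the slab lie in S, so one supremum is 0. A point of S is moved vertically into
  the slab by at most d; l \<le> u ensures that the target fibre is nonempty.\<close>

lemma hausdorff_dist_slab_le:
  assumes lu: "\<And>x y. x \<in> A \<Longrightarrow> y \<in> B \<Longrightarrow> l x y \<le> u x y" and "0 \<le> d"
    and inner: "slab A B l u \<subseteq> S"
    and outer: "S \<subseteq> slab A B (\<lambda>x y. l x y - d) (\<lambda>x y. u x y + d)"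
  shows "hausdorff_dist S (slab A B l u) \<le> ennreal d"
proof -
  let ?T = "slab A B l u"
  have "(INF q\<in>?T. ennreal (dist p q)) \<le> ennreal d" if "p \<in> S" for p
  proof -
    obtain x y z where p: "p = (x, y, z)" by (cases p)
    have xyz: "x \<in> A" "y \<in> B" "l x y - d \<le> z" "z \<le> u x y + d"
      using that outer by (auto simp: slab_def p)
    \<comment> \<open>The height z clamped to the interval from l to u.\<close>
    define z' where "z' = max (l x y) (min (u x y) z)"
    have "(x, y, z') \<in> ?T" using xyz lu[of x y] by (auto simp: slab_def z'_def)
    moreover have "dist p (x, y, z') \<le> d"
      using xyz lu[of x y] \<open>0 \<le> d\<close> by (auto simp: p dist_Pair_Pair dist_real_def z'_def)
    ultimately show ?thesis
      by (meson INF_lower ennreal_leI order_trans)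
  qed
  moreover have "(INF p\<in>S. ennreal (dist p q)) \<le> ennreal d" if "q \<in> ?T" for q
  proof -
    have "(INF p\<in>S. ennreal (dist p q)) \<le> ennreal (dist q q)"
      using that inner by (intro INF_lower) auto
    then show ?thesis by (simp add: order_trans[OF _ zero_le])
  qed
  ultimately show ?thesis
    unfolding hausdorff_dist_def by (intro max.boundedI SUP_least) auto
qed

text \<open>A squeeze between the slab and its vertical thickening. The error may depend on
  \<open>L1\<close> alone: the relaxed upper bound by the secant is exact at every level L, and only
  the lower bounds carry a tolerance.\<close>

lemma hausdorff_limit_slab:
  assumes "closed A" "closed B"
    and "continuous_on UNIV (\<lambda>(x, y). l x y)" "continuous_on UNIV (\<lambda>(x, y). u x y)"
    and "\<And>x y. x \<in> A \<Longrightarrow> y \<in> B \<Longrightarrow> l x y \<le> u x y"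
    and "\<And>n. 0 \<le> d n" and d: "d \<longlonglongrightarrow> 0"
    and "\<And>L L1. L \<le> L1 \<Longrightarrow> slab A B l u \<subseteq> F L L1"
    and "\<And>L L1. L \<le> L1 \<Longrightarrow> F L L1 \<subseteq> slab A B (\<lambda>x y. l x y - d L1) (\<lambda>x y. u x y + d L1)"
  shows "hausdorff_limit F (slab A B l u)"
  unfolding hausdorff_limit_def
proof
  show "closed (slab A B l u)" using assms by (intro closed_slab)
  have "filterlim snd sequentially level_filter"
    unfolding level_filter_def by (rule filterlim_mono[OF filterlim_snd order_refl inf_le1])
  from filterlim_compose[OF tendsto_ennrealI[OF d] this]
  have lim: "((\<lambda>p. ennreal (d (snd p))) \<longlongrightarrow> 0) level_filter" by simp
  have "eventually (\<lambda>(L, L1). hausdorff_dist (F L L1) (slab A B l u) \<le> ennreal (d L1)) level_filter"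
    unfolding level_filter_def eventually_inf_principal
    using hausdorff_dist_slab_le[OF assms(5,6,8,9)] by (intro always_eventually) auto
  then show "((\<lambda>(L, L1). hausdorff_dist (F L L1) (slab A B l u)) \<longlongrightarrow> 0) level_filter"
    by (intro tendsto_sandwich[OF _ _ tendsto_const lim]) (auto simp: split_def)
qed

section \<open>Volumes by iterated integration\<close>

lemma emeasure_lborel_slices:
  fixes S :: "('a::euclidean_space \<times> 'b::euclidean_space) set"
  assumes "S \<in> sets borel"
  shows "emeasure lborel S = (\<integral>\<^sup>+ x. emeasure lborel (Pair x -` S) \<partial>lborel)"
proof -
  have "S \<in> sets (lborel \<Otimes>\<^sub>M lborel)"
    using assms by (simp only: lborel_prod sets_lborel)
  from lborel.emeasure_pair_measure_alt[OF this] show ?thesis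
    by (simp only: lborel_prod)
qed

text \<open>Slicing twice leaves segments of length \<open>h x y\<close>; \<open>G\<close> is an
  antiderivative of this in y, and \<open>K\<close> one of the resulting area in x.\<close>

lemma measure_slab_FTC:
  fixes h :: "real \<Rightarrow> real \<Rightarrow> real"
  assumes "a \<le> b" "c \<le> e"
    and l: "continuous_on UNIV (\<lambda>(x, y). l x y)" and u: "continuous_on UNIV (\<lambda>(x, y). u x y)"
    and h: "\<And>x y. u x y - l x y = h x y"
    and nonneg: "\<And>x y. x \<in> {a..b} \<Longrightarrow> y \<in> {c..e} \<Longrightarrow> 0 \<le> h x y"
    and G: "\<And>x y. (G x has_real_derivative h x y) (at y)"
    and K: "\<And>x. (K has_real_derivative G x e - G x c) (at x)"
    and meas: "(\<lambda>x. G x e - G x c) \<in> borel_measurable borel" "\<And>x. h x \<in> borel_measurable borel"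
  shows "measure lborel (slab {a..b} {c..e} l u) = K b - K a"
proof -
  let ?S = "slab {a..b} {c..e} l u"
  have S: "?S \<in> sets borel"
    using l u by (intro borel_closed closed_slab) auto
  \<comment> \<open>The fundamental theorem for nonnegative integrals needs a nonnegative slice
    area, which follows from the monotonicity of \<open>G x\<close>.\<close>
  have Gmono: "0 \<le> G x e - G x c" if "x \<in> {a..b}" for x
    using DERIV_nonneg_imp_nondecreasing[of c e "G x"] assms(2) G nonneg that by fastforce
  have Kmono: "0 \<le> K b - K a"
    using DERIV_nonneg_imp_nondecreasing[of a b K] assms(1) K Gmono by fastforce
  have slice: "emeasure (lborel :: (real \<times> real) measure) (Pair x -` ?S) =
      ennreal (G x e - G x c) * indicator {a..b} x" for x
  proof (cases "x \<in> {a..b}")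
    case True
    have "Pair x -` ?S \<in> sets borel"
      using measurable_sets[of "Pair x" borel borel ?S] S by simp
    then have "emeasure (lborel :: (real \<times> real) measure) (Pair x -` ?S) =
        (\<integral>\<^sup>+ y. emeasure lborel (Pair y -` Pair x -` ?S) \<partial>lborel)"
      by (rule emeasure_lborel_slices)
    also have "\<dots> = (\<integral>\<^sup>+ y. ennreal (h x y) * indicator {c..e} y \<partial>lborel)"
    proof (intro nn_integral_cong)
      fix y :: real
      have "Pair y -` Pair x -` ?S = (if y \<in> {c..e} then {l x y..u x y} else {})"
        using True by (auto simp: slab_def)
      then show "emeasure lborel (Pair y -` Pair x -` ?S) = ennreal (h x y) * indicator {c..e} y"
        using h[of x y] nonneg[OF True, of y]
        by (auto simp del: atLeastAtMost_iff)
    qed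
    also have "\<dots> = ennreal (G x e - G x c)"
      using assms(2) meas G nonneg[OF True] by (intro nn_integral_FTC_Icc) (auto simp: has_real_derivative_iff_has_vector_derivative)
    finally show ?thesis using True by simp
  qed (auto simp: slab_def)
  have "emeasure lborel ?S =
      (\<integral>\<^sup>+ x. emeasure (lborel :: (real \<times> real) measure) (Pair x -` ?S) \<partial>lborel)"
    using S by (rule emeasure_lborel_slices)
  also have "\<dots> = (\<integral>\<^sup>+ x. ennreal (G x e - G x c) * indicator {a..b} x \<partial>lborel)"
    by (simp add: slice)
  also have "\<dots> = ennreal (K b - K a)"
    using assms(1) meas K Gmono by (intro nn_integral_FTC_Icc) auto
  finally show ?thesis
    using Kmono by (simp add: measure_def)
qed

text \<open>All three limit sets have this thickness: that of HybS plus a bilinear polynomial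
  centred at the lower corner. The antiderivatives in the proof are chosen to vanish at that
  corner.\<close>

lemma measure_slab_quadratic:
  fixes a b c d xl xu yl yu :: real
  defines "h \<equiv> \<lambda>x y. (x - xl) * (xu - x) + (y - yl) * (yu - y)
    + (a + b * (x - xl) + c * (y - yl) + d * (x - xl) * (y - yl))"
  assumes "xl \<le> xu" "yl \<le> yu"
    and "continuous_on UNIV (\<lambda>(x, y). l x y)" "continuous_on UNIV (\<lambda>(x, y). u x y)"
    and "\<And>x y. u x y - l x y = h x y"
    and "\<And>x y. x \<in> {xl..xu} \<Longrightarrow> y \<in> {yl..yu} \<Longrightarrow> 0 \<le> h x y"
  shows "measure lborel (slab {xl..xu} {yl..yu} l u) =
    (xu - xl) ^ 3 * (yu - yl) / 6 + (xu - xl) * (yu - yl) ^ 3 / 6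
    + a * (xu - xl) * (yu - yl) + b * (xu - xl)\<^sup>2 * (yu - yl) / 2
    + c * (xu - xl) * (yu - yl)\<^sup>2 / 2 + d * (xu - xl)\<^sup>2 * (yu - yl)\<^sup>2 / 4"
proof -
  define G where "G x y = (x - xl) * (xu - x) * (y - yl)
    + ((yu - yl) * (y - yl)\<^sup>2 / 2 - (y - yl) ^ 3 / 3) + a * (y - yl) + b * (x - xl) * (y - yl)
    + c * (y - yl)\<^sup>2 / 2 + d * (x - xl) * (y - yl)\<^sup>2 / 2" for x y
  define K where "K x = ((xu - xl) * (x - xl)\<^sup>2 / 2 - (x - xl) ^ 3 / 3) * (yu - yl)
    + (yu - yl) ^ 3 / 6 * (x - xl) + a * (yu - yl) * (x - xl) + b * (yu - yl) * (x - xl)\<^sup>2 / 2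
    + c * (yu - yl)\<^sup>2 / 2 * (x - xl) + d * (yu - yl)\<^sup>2 * (x - xl)\<^sup>2 / 4" for x
  have "measure lborel (slab {xl..xu} {yl..yu} l u) = K xu - K xl"
  proof (rule measure_slab_FTC[where h = h and G = G])
    show "(G x has_real_derivative h x y) (at y)" for x y
      unfolding G_def h_def
      by (auto intro!: derivative_eq_intros) (simp add: field_simps power2_eq_square power3_eq_cube)
    show "(K has_real_derivative G x yu - G x yl) (at x)" for x
      unfolding G_def K_def
      by (auto intro!: derivative_eq_intros) (simp add: field_simps power2_eq_square power3_eq_cube)
    show "(\<lambda>x. G x yu - G x yl) \<in> borel_measurable borel" "h x \<in> borel_measurable borel" for x
      unfolding G_def h_def by measurable
  qed (use assms in auto)
  moreover have "K xl = 0" by (simp add: K_def)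
  moreover have "w * w\<^sup>2 / 2 - w ^ 3 / 3 = w ^ 3 / 6" for w :: real
    by (simp add: power2_eq_square power3_eq_cube)
  then have "K xu = (xu - xl) ^ 3 * (yu - yl) / 6 + (xu - xl) * (yu - yl) ^ 3 / 6
    + a * (xu - xl) * (yu - yl) + b * (xu - xl)\<^sup>2 * (yu - yl) / 2
    + c * (xu - xl) * (yu - yl)\<^sup>2 / 2 + d * (xu - xl)\<^sup>2 * (yu - yl)\<^sup>2 / 4"
    by (simp only: K_def times_divide_eq_left times_divide_eq_right mult_ac)
  ultimately show ?thesis by simp
qed

subsection \<open>The limit sets\<close>

definition secant_gap :: "real \<Rightarrow> real \<Rightarrow> real \<Rightarrow> real" where
  "secant_gap a b t = (t - a) * (b - t)"

lemma secant_eq: "(a + b) * t - a * b = t\<^sup>2 + secant_gap a b t"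
  by (simp add: secant_gap_def power2_eq_square algebra_simps)

lemma secant_gap_nonneg: "t \<in> {a..b} \<Longrightarrow> 0 \<le> secant_gap a b t"
  by (simp add: secant_gap_def)

lemma R_on_lp_exists_gap:
  assumes "a < b" "L \<le> L1" "t \<in> {a..b}" "s \<in> {0..secant_gap a b t}"
  shows "\<exists>g \<alpha>. R_on {0..1} a b L L1 t (t\<^sup>2 + s) g \<alpha>"
  using assms by (intro R_on_lp_exists) (auto simp: secant_eq)

text \<open>Greedy splitting: fill \<open>g\<close> first and leave the rest to \<open>h\<close>. It
  distributes a prescribed excess of z_x + z_y over the two variables.\<close>

lemma nonneg_split_sum:
  fixes s g h :: real
  assumes "0 \<le> s" "s \<le> g + h" "0 \<le> g" "0 \<le> h"
  obtains b c where "b \<in> {0..g}" "c \<in> {0..h}" "s = b + c"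
  using that[of "min g s" "s - min g s"] assms by auto

lemma plus_square: "(x + y)\<^sup>2 = x\<^sup>2 + y\<^sup>2 + 2 * (x * y)" for x y :: real
  by (simp add: power2_sum)

lemma minus_square: "(x - y)\<^sup>2 = x\<^sup>2 + y\<^sup>2 - 2 * (x * y)" for x y :: real
  by (simp add: power2_diff)

context
  fixes xl xu yl yu :: real
  assumes x_less: "xl < xu" and y_less: "yl < yu"
begin

lemma sum_less: "xl + yl < xu + yu" and diff_less: "xl - yu < xu - yl"
  using x_less y_less by simp_all

text \<open>The divisor 2 here and in the next two gaps comes from writing xy as half of a signed
  sum of squares.\<close>

definition half_gap :: "real \<Rightarrow> real \<Rightarrow> real" where
  "half_gap x y = (secant_gap xl xu x + secant_gap yl yu y) / 2"

definition plus_gap :: "real \<Rightarrow> real \<Rightarrow> real" where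
  "plus_gap x y = secant_gap (xl + yl) (xu + yu) (x + y) / 2"

definition minus_gap :: "real \<Rightarrow> real \<Rightarrow> real" where
  "minus_gap x y = secant_gap (xl - yu) (xu - yl) (x - y) / 2"

lemmas gap_defs = half_gap_def plus_gap_def minus_gap_def

abbreviation "box_slab \<equiv> slab {xl..xu} {yl..yu}"

definition hybs_lim :: "point set" where
  "hybs_lim = box_slab (\<lambda>x y. x * y - half_gap x y) (\<lambda>x y. x * y + half_gap x y)"

definition bin2_lim :: "point set" where
  "bin2_lim = box_slab (\<lambda>x y. x * y - half_gap x y) (\<lambda>x y. x * y + plus_gap x y)"

definition bin3_lim :: "point set" where
  "bin3_lim = box_slab (\<lambda>x y. x * y - minus_gap x y) (\<lambda>x y. x * y + half_gap x y)"

lemma secant_gap_eqs: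
  "secant_gap xl xu x + secant_gap yl yu y = 2 * half_gap x y"
  "secant_gap (xl + yl) (xu + yu) (x + y) = 2 * plus_gap x y"
  "secant_gap (xl - yu) (xu - yl) (x - y) = 2 * minus_gap x y"
  by (simp_all add: gap_defs)

lemma gaps_nonneg:
  assumes "x \<in> {xl..xu}" "y \<in> {yl..yu}"
  shows "0 \<le> half_gap x y" "0 \<le> plus_gap x y" "0 \<le> minus_gap x y"
  using assms unfolding gap_defs by (auto intro!: add_nonneg_nonneg secant_gap_nonneg)

lemma plus_gap_eq:
  "plus_gap x y = half_gap x y + ((x - xl) * (yu - y) + (y - yl) * (xu - x)) / 2"
  by (simp add: gap_defs secant_gap_def field_simps)

lemma minus_gap_eq:
  "minus_gap x y = half_gap x y + ((x - xl) * (y - yl) + (xu - x) * (yu - y)) / 2"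
  by (simp add: gap_defs secant_gap_def field_simps)

lemma half_gap_le:
  assumes "x \<in> {xl..xu}" "y \<in> {yl..yu}"
  shows "half_gap x y \<le> plus_gap x y" "half_gap x y \<le> minus_gap x y"
  using assms unfolding plus_gap_eq minus_gap_eq by simp_all

lemma continuous_gaps:
  "continuous_on UNIV (\<lambda>(x, y). x * y - half_gap x y)"
  "continuous_on UNIV (\<lambda>(x, y). x * y + half_gap x y)"
  "continuous_on UNIV (\<lambda>(x, y). x * y + plus_gap x y)"
  "continuous_on UNIV (\<lambda>(x, y). x * y - minus_gap x y)"
  unfolding gap_defs secant_gap_def split_def by (intro continuous_intros; simp)+

text \<open>The squared width of the intervals of x + y and x - y coincides, and it dominates w_x^2
  + w_y^2, so one error serves every lower bound in use.\<close>

definition gap_err :: "nat \<Rightarrow> real" where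
  "gap_err n = ((xu - xl) + (yu - yl))\<^sup>2 / 2 ^ (2 * n + 2)"

lemma gap_err_nonneg: "0 \<le> gap_err n"
  by (simp add: gap_err_def)

lemma gap_err_tendsto: "gap_err \<longlonglongrightarrow> 0"
proof -
  have "(\<lambda>n. ((xu - xl) + (yu - yl))\<^sup>2 / 4 * (1 / 4) ^ n) \<longlonglongrightarrow> 0"
    by (intro tendsto_mult_right_zero LIMSEQ_power_zero) simp
  moreover have "gap_err = (\<lambda>n. ((xu - xl) + (yu - yl))\<^sup>2 / 4 * (1 / 4) ^ n)"
    by (simp add: gap_err_def fun_eq_iff power_mult power_add power_one_over)
  ultimately show ?thesis by simp
qed

lemma gap_err_bounds:
  "(xu - xl)\<^sup>2 / 2 ^ (2 * n + 2) + (yu - yl)\<^sup>2 / 2 ^ (2 * n + 2) \<le> gap_err n"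
  "((xu + yu) - (xl + yl))\<^sup>2 / 2 ^ (2 * n + 2) = gap_err n"
  "((xu - yl) - (xl - yu))\<^sup>2 / 2 ^ (2 * n + 2) = gap_err n"
proof -
  have "(xu - xl)\<^sup>2 + (yu - yl)\<^sup>2 \<le> ((xu - xl) + (yu - yl))\<^sup>2"
    using x_less y_less by (simp add: power2_sum)
  then show "(xu - xl)\<^sup>2 / 2 ^ (2 * n + 2) + (yu - yl)\<^sup>2 / 2 ^ (2 * n + 2) \<le> gap_err n"
    unfolding gap_err_def add_divide_distrib[symmetric] by (rule divide_right_mono) simp
qed (simp_all add: gap_err_def algebra_simps)

lemma R_on_xy_bounds:
  assumes "L \<le> L1" "R_on B xl xu L L1 x zx gx \<alpha>x" "R_on B yl yu L L1 y zy gy \<alpha>y"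
  shows "x\<^sup>2 + y\<^sup>2 - gap_err L1 \<le> zx + zy" "zx + zy \<le> x\<^sup>2 + y\<^sup>2 + 2 * half_gap x y"
  using R_on_lower[OF x_less assms(2)] R_on_lower[OF y_less assms(3)] gap_err_bounds(1)[of L1]
    R_on_upper[OF x_less assms(1,2)] R_on_upper[OF y_less assms(1,3)]
    secant_gap_eqs(1)[of x y]
  unfolding secant_eq by linarith+

text \<open>The formulations involve z_x and z_y only through their sum, so it suffices to realize
  every excess of the sum up to the joint secant gap.\<close>

lemma R_on_xy_exists:
  assumes "L \<le> L1" "x \<in> {xl..xu}" "y \<in> {yl..yu}" "s \<in> {0..2 * half_gap x y}"
  obtains zx zy gx \<alpha>x gy \<alpha>y where "zx + zy = x\<^sup>2 + y\<^sup>2 + s"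
    "R_on {0..1} xl xu L L1 x zx gx \<alpha>x" "R_on {0..1} yl yu L L1 y zy gy \<alpha>y"
proof -
  obtain b c where "b \<in> {0..secant_gap xl xu x}" "c \<in> {0..secant_gap yl yu y}" "s = b + c"
    using nonneg_split_sum[of s "secant_gap xl xu x" "secant_gap yl yu y"] assms secant_gap_nonneg
    by (auto simp: half_gap_def)
  moreover from this obtain gx \<alpha>x gy \<alpha>y where "R_on {0..1} xl xu L L1 x (x\<^sup>2 + b) gx \<alpha>x"
    "R_on {0..1} yl yu L L1 y (y\<^sup>2 + c) gy \<alpha>y"
    using R_on_lp_exists_gap[OF x_less assms(1,2)] R_on_lp_exists_gap[OF y_less assms(1,3)] by blast
  ultimately show ?thesis
    using that[of "x\<^sup>2 + b" "y\<^sup>2 + c"] by simp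
qed

section \<open>Hausdorff limits of the three projections\<close>

lemma hausdorff_limit_hybs: "hausdorff_limit (hybs_lp_proj xl xu yl yu) hybs_lim"
  unfolding hybs_lim_def
proof (rule hausdorff_limit_slab[where d = gap_err])
  fix L L1 :: nat assume le: "L \<le> L1"
  show "box_slab (\<lambda>x y. x * y - half_gap x y) (\<lambda>x y. x * y + half_gap x y)
      \<subseteq> hybs_lp_proj xl xu yl yu L L1"
  proof
    fix p assume "p \<in> box_slab (\<lambda>x y. x * y - half_gap x y) (\<lambda>x y. x * y + half_gap x y)"
    then obtain x y z where p: "p = (x, y, z)" and xy: "x \<in> {xl..xu}" "y \<in> {yl..yu}"
      and z: "x * y - half_gap x y \<le> z" "z \<le> x * y + half_gap x y"
      by (auto simp: slab_def)
    \<comment> \<open>The largest z_x + z_y, together with exact squares for z_p1 and z_p2, loosens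
      both inequalities on z at once, so one choice serves every z in the fibre.\<close>
    obtain zx zy gx \<alpha>x gy \<alpha>y where R: "zx + zy = x\<^sup>2 + y\<^sup>2 + 2 * half_gap x y"
      "R_on {0..1} xl xu L L1 x zx gx \<alpha>x" "R_on {0..1} yl yu L L1 y zy gy \<alpha>y"
      using R_on_xy_exists[OF le xy, of "2 * half_gap x y"] gaps_nonneg(1)[OF xy]
      by (metis atLeastAtMost_iff order_refl zero_le_mult_iff zero_le_numeral)
    have "x + y \<in> {xl + yl..xu + yu}" "x - y \<in> {xl - yu..xu - yl}"
      using xy by auto
    then obtain gp1 gp2 where "Q_on (xl + yl) (xu + yu) L1 (x + y) ((x + y)\<^sup>2) gp1"
      "Q_on (xl - yu) (xu - yl) L1 (x - y) ((x - y)\<^sup>2) gp2"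
      using Q_on_exists[OF sum_less] Q_on_exists[OF diff_less] by blast
    moreover have "((x + y)\<^sup>2 - zx - zy) / 2 \<le> z" "z \<le> (zx + zy - (x - y)\<^sup>2) / 2"
      using R(1) z unfolding plus_square minus_square by (simp_all add: field_simps)
    ultimately have "((x, y, z), (x + y, x - y, zx, zy, (x + y)\<^sup>2, (x - y)\<^sup>2), (gx, \<alpha>x), (gy, \<alpha>y), gp1, gp2)
        \<in> hybs {0..1} xl xu yl yu L L1"
      using R xy by (simp add: hybs_def)
    then show "p \<in> hybs_lp_proj xl xu yl yu L L1"
      unfolding hybs_lp_proj_def p by force
  qed
  show "hybs_lp_proj xl xu yl yu L L1 \<subseteq>
      box_slab (\<lambda>x y. x * y - half_gap x y - gap_err L1) (\<lambda>x y. x * y + half_gap x y + gap_err L1)"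
  proof
    fix p assume "p \<in> hybs_lp_proj xl xu yl yu L L1"
    then obtain x y z zx zy zp1 zp2 gx \<alpha>x gy \<alpha>y gp1 gp2 where p: "p = (x, y, z)"
      and xy: "x \<in> {xl..xu}" "y \<in> {yl..yu}"
      and R: "R_on {0..1} xl xu L L1 x zx gx \<alpha>x" "R_on {0..1} yl yu L L1 y zy gy \<alpha>y"
      and Q: "Q_on (xl + yl) (xu + yu) L1 (x + y) zp1 gp1" "Q_on (xl - yu) (xu - yl) L1 (x - y) zp2 gp2"
      and "(zp1 - zx - zy) / 2 \<le> z" "z \<le> (zx + zy - zp2) / 2"
      unfolding hybs_lp_proj_def hybs_def by (auto simp only: fst_conv)
    then have "zp1 - zx - zy \<le> 2 * z" "2 * z \<le> zx + zy - zp2" by simp_all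
    then have "x * y - half_gap x y - gap_err L1 \<le> z" "z \<le> x * y + half_gap x y + gap_err L1"
      using R_on_xy_bounds[OF le R] Q_on_lower[OF sum_less Q(1)] Q_on_lower[OF diff_less Q(2)]
        gap_err_nonneg[of L1]
      unfolding gap_err_bounds(2,3) unfolding plus_square minus_square by linarith+
    then show "p \<in> box_slab (\<lambda>x y. x * y - half_gap x y - gap_err L1) (\<lambda>x y. x * y + half_gap x y + gap_err L1)"
      using xy by (simp add: slab_def p)
  qed
next
  show "x * y - half_gap x y \<le> x * y + half_gap x y" if "x \<in> {xl..xu}" "y \<in> {yl..yu}" for x y
    using gaps_nonneg(1)[OF that] by linarith
qed (rule continuous_gaps gap_err_nonneg gap_err_tendsto closed_atLeastAtMost)+

lemma hausdorff_limit_bin2: "hausdorff_limit (bin2_lp_proj xl xu yl yu) bin2_lim"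
  unfolding bin2_lim_def
proof (rule hausdorff_limit_slab[where d = gap_err])
  fix L L1 :: nat assume le: "L \<le> L1"
  show "box_slab (\<lambda>x y. x * y - half_gap x y) (\<lambda>x y. x * y + plus_gap x y)
      \<subseteq> bin2_lp_proj xl xu yl yu L L1"
  proof
    fix p assume "p \<in> box_slab (\<lambda>x y. x * y - half_gap x y) (\<lambda>x y. x * y + plus_gap x y)"
    then obtain x y z where p: "p = (x, y, z)" and xy: "x \<in> {xl..xu}" "y \<in> {yl..yu}"
      and z: "x * y - half_gap x y \<le> z" "z \<le> x * y + plus_gap x y"
      by (auto simp: slab_def)
    \<comment> \<open>Here z is fixed by an equation: the excess \<open>s\<close> of z_x + z_y
      lowers it below xy and the excess \<open>r\<close> of z_p raises it. The choice gives r - s =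
      2 (z - xy), with at most one of them nonzero.\<close>
    define s where "s = max 0 (2 * (x * y - z))"
    define r where "r = max 0 (2 * (z - x * y))"
    have s: "s \<in> {0..2 * half_gap x y}"
      unfolding s_def atLeastAtMost_iff using z gaps_nonneg[OF xy] by (simp add: plus_gap_def minus_gap_def)
    have r: "r \<in> {0..secant_gap (xl + yl) (xu + yu) (x + y)}"
      unfolding r_def atLeastAtMost_iff using z gaps_nonneg[OF xy] by (simp add: plus_gap_def minus_gap_def)
    obtain zx zy gx \<alpha>x gy \<alpha>y where R: "zx + zy = x\<^sup>2 + y\<^sup>2 + s"
      "R_on {0..1} xl xu L L1 x zx gx \<alpha>x" "R_on {0..1} yl yu L L1 y zy gy \<alpha>y"
      using R_on_xy_exists[OF le xy s] .
    obtain gp \<alpha>p where "R_on {0..1} (xl + yl) (xu + yu) L L1 (x + y) ((x + y)\<^sup>2 + r) gp \<alpha>p"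
      using R_on_lp_exists_gap[OF sum_less le _ r] xy by auto
    moreover have "z = ((x + y)\<^sup>2 + r - zx - zy) / 2"
      using R(1) unfolding plus_square s_def r_def by (simp add: max_def field_simps)
    ultimately have "((x, y, z), (x + y, zx, zy, (x + y)\<^sup>2 + r), (gx, \<alpha>x), (gy, \<alpha>y), gp, \<alpha>p)
        \<in> bin2 {0..1} xl xu yl yu L L1"
      using R xy by (simp add: bin2_def)
    then show "p \<in> bin2_lp_proj xl xu yl yu L L1"
      unfolding bin2_lp_proj_def p by force
  qed
  show "bin2_lp_proj xl xu yl yu L L1 \<subseteq>
      box_slab (\<lambda>x y. x * y - half_gap x y - gap_err L1) (\<lambda>x y. x * y + plus_gap x y + gap_err L1)"
  proof
    fix p assume "p \<in> bin2_lp_proj xl xu yl yu L L1"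
    then obtain x y z zx zy zp gx \<alpha>x gy \<alpha>y gp \<alpha>p where p: "p = (x, y, z)"
      and xy: "x \<in> {xl..xu}" "y \<in> {yl..yu}"
      and R: "R_on {0..1} xl xu L L1 x zx gx \<alpha>x" "R_on {0..1} yl yu L L1 y zy gy \<alpha>y"
      and P: "R_on {0..1} (xl + yl) (xu + yu) L L1 (x + y) zp gp \<alpha>p"
      and "z = (zp - zx - zy) / 2"
      unfolding bin2_lp_proj_def bin2_def by (auto simp only: fst_conv)
    then have "2 * z = zp - zx - zy" by simp
    then have "x * y - half_gap x y - gap_err L1 \<le> z" "z \<le> x * y + plus_gap x y + gap_err L1"
      using R_on_xy_bounds[OF le R] R_on_lower[OF sum_less P] R_on_upper[OF sum_less le P]
        gap_err_nonneg[of L1]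
      unfolding gap_err_bounds(2) unfolding secant_eq secant_gap_eqs(2) plus_square by linarith+
    then show "p \<in> box_slab (\<lambda>x y. x * y - half_gap x y - gap_err L1) (\<lambda>x y. x * y + plus_gap x y + gap_err L1)"
      using xy by (simp add: slab_def p)
  qed
next
  show "x * y - half_gap x y \<le> x * y + plus_gap x y" if "x \<in> {xl..xu}" "y \<in> {yl..yu}" for x y
    using gaps_nonneg[OF that] by linarith
qed (rule continuous_gaps gap_err_nonneg gap_err_tendsto closed_atLeastAtMost)+

lemma hausdorff_limit_bin3: "hausdorff_limit (bin3_lp_proj xl xu yl yu) bin3_lim"
  unfolding bin3_lim_def
proof (rule hausdorff_limit_slab[where d = gap_err])
  fix L L1 :: nat assume le: "L \<le> L1"
  show "box_slab (\<lambda>x y. x * y - minus_gap x y) (\<lambda>x y. x * y + half_gap x y)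
      \<subseteq> bin3_lp_proj xl xu yl yu L L1"
  proof
    fix p assume "p \<in> box_slab (\<lambda>x y. x * y - minus_gap x y) (\<lambda>x y. x * y + half_gap x y)"
    then obtain x y z where p: "p = (x, y, z)" and xy: "x \<in> {xl..xu}" "y \<in> {yl..yu}"
      and z: "x * y - minus_gap x y \<le> z" "z \<le> x * y + half_gap x y"
      by (auto simp: slab_def)
    \<comment> \<open>The signs are opposite to Bin2: \<open>s\<close> raises z above xy and
      \<open>r\<close> lowers it.\<close>
    define s where "s = max 0 (2 * (z - x * y))"
    define r where "r = max 0 (2 * (x * y - z))"
    have s: "s \<in> {0..2 * half_gap x y}"
      unfolding s_def atLeastAtMost_iff using z gaps_nonneg[OF xy] by (simp add: plus_gap_def minus_gap_def)
    have r: "r \<in> {0..secant_gap (xl - yu) (xu - yl) (x - y)}"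
      unfolding r_def atLeastAtMost_iff using z gaps_nonneg[OF xy] by (simp add: plus_gap_def minus_gap_def)
    obtain zx zy gx \<alpha>x gy \<alpha>y where R: "zx + zy = x\<^sup>2 + y\<^sup>2 + s"
      "R_on {0..1} xl xu L L1 x zx gx \<alpha>x" "R_on {0..1} yl yu L L1 y zy gy \<alpha>y"
      using R_on_xy_exists[OF le xy s] .
    obtain gp \<alpha>p where "R_on {0..1} (xl - yu) (xu - yl) L L1 (x - y) ((x - y)\<^sup>2 + r) gp \<alpha>p"
      using R_on_lp_exists_gap[OF diff_less le _ r] xy by auto
    moreover have "z = (zx + zy - ((x - y)\<^sup>2 + r)) / 2"
      using R(1) unfolding minus_square s_def r_def by (simp add: max_def field_simps)
    ultimately have "((x, y, z), (x - y, zx, zy, (x - y)\<^sup>2 + r), (gx, \<alpha>x), (gy, \<alpha>y), gp, \<alpha>p)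
        \<in> bin3 {0..1} xl xu yl yu L L1"
      using R xy by (simp add: bin3_def)
    then show "p \<in> bin3_lp_proj xl xu yl yu L L1"
      unfolding bin3_lp_proj_def p by force
  qed
  show "bin3_lp_proj xl xu yl yu L L1 \<subseteq>
      box_slab (\<lambda>x y. x * y - minus_gap x y - gap_err L1) (\<lambda>x y. x * y + half_gap x y + gap_err L1)"
  proof
    fix p assume "p \<in> bin3_lp_proj xl xu yl yu L L1"
    then obtain x y z zx zy zp gx \<alpha>x gy \<alpha>y gp \<alpha>p where p: "p = (x, y, z)"
      and xy: "x \<in> {xl..xu}" "y \<in> {yl..yu}"
      and R: "R_on {0..1} xl xu L L1 x zx gx \<alpha>x" "R_on {0..1} yl yu L L1 y zy gy \<alpha>y"
      and P: "R_on {0..1} (xl - yu) (xu - yl) L L1 (x - y) zp gp \<alpha>p"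
      and "z = (zx + zy - zp) / 2"
      unfolding bin3_lp_proj_def bin3_def by (auto simp only: fst_conv)
    then have "2 * z = zx + zy - zp" by simp
    then have "x * y - minus_gap x y - gap_err L1 \<le> z" "z \<le> x * y + half_gap x y + gap_err L1"
      using R_on_xy_bounds[OF le R] R_on_lower[OF diff_less P] R_on_upper[OF diff_less le P]
        gap_err_nonneg[of L1]
      unfolding gap_err_bounds(3) unfolding secant_eq secant_gap_eqs(3) minus_square by linarith+
    then show "p \<in> box_slab (\<lambda>x y. x * y - minus_gap x y - gap_err L1) (\<lambda>x y. x * y + half_gap x y + gap_err L1)"
      using xy by (simp add: slab_def p)
  qed
next
  show "x * y - minus_gap x y \<le> x * y + half_gap x y" if "x \<in> {xl..xu}" "y \<in> {yl..yu}" for x y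
    using gaps_nonneg[OF that] by linarith
qed (rule continuous_gaps gap_err_nonneg gap_err_tendsto closed_atLeastAtMost)+

section \<open>Inclusions and volumes of the limit sets\<close>

lemma hybs_lim_subset: "hybs_lim \<subseteq> bin2_lim" "hybs_lim \<subseteq> bin3_lim"
proof -
  have "x * y + half_gap x y \<le> x * y + plus_gap x y" "x * y - minus_gap x y \<le> x * y - half_gap x y"
    if "x \<in> {xl..xu}" "y \<in> {yl..yu}" for x y
    using half_gap_le[OF that] by linarith+
  then show "hybs_lim \<subseteq> bin2_lim" "hybs_lim \<subseteq> bin3_lim"
    unfolding hybs_lim_def bin2_lim_def bin3_lim_def slab_def by (blast intro: order_trans)+
qed

lemma measure_hybs_lim:
  "measure lborel hybs_lim =
    (xu - xl) ^ 3 * (yu - yl) / 6 + (xu - xl) * (yu - yl) ^ 3 / 6"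
proof -
  have "0 \<le> (x - xl) * (xu - x) + (y - yl) * (yu - y)"
    if "x \<in> {xl..xu}" "y \<in> {yl..yu}" for x y
    using gaps_nonneg(1)[OF that] by (simp add: gap_defs secant_gap_def)
  then show ?thesis
    unfolding hybs_lim_def using x_less y_less continuous_gaps
    by (subst measure_slab_quadratic[where a = 0 and b = 0 and c = 0 and d = 0])
      (auto simp: gap_defs secant_gap_def)
qed

lemma measure_bin2_lim:
  "measure lborel bin2_lim = measure lborel hybs_lim + 1 / 4 * (xu - xl)\<^sup>2 * (yu - yl)\<^sup>2"
proof -
  \<comment> \<open>Replacing yu - y by w_y - (y - yl), and likewise in x, expands the cross terms
    about the lower corner. The coefficients contribute 1/4 + 1/4 - 1/4 of w_x^2 w_y^2.\<close>
  have h: "(x * y + plus_gap x y) - (x * y - half_gap x y)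
    = (x - xl) * (xu - x) + (y - yl) * (yu - y)
    + (0 + (yu - yl) / 2 * (x - xl) + (xu - xl) / 2 * (y - yl) + - 1 * (x - xl) * (y - yl))" for x y
    unfolding plus_gap_eq by (simp add: half_gap_def secant_gap_def field_simps)
  have nonneg: "0 \<le> (x * y + plus_gap x y) - (x * y - half_gap x y)"
    if "x \<in> {xl..xu}" "y \<in> {yl..yu}" for x y
    using gaps_nonneg[OF that] by linarith
  show ?thesis
    unfolding measure_hybs_lim unfolding bin2_lim_def
    using x_less y_less continuous_gaps nonneg
    by (subst measure_slab_quadratic[OF _ _ _ _ h]) (simp_all add: h, simp add: power2_eq_square field_simps)
qed

lemma measure_bin3_lim:
  "measure lborel bin3_lim = measure lborel hybs_lim + 1 / 4 * (xu - xl)\<^sup>2 * (yu - yl)\<^sup>2"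
proof -
  \<comment> \<open>The same expansion; the contributions are now 1/2 - 1/4 - 1/4 + 1/4.\<close>
  have h: "(x * y + half_gap x y) - (x * y - minus_gap x y)
    = (x - xl) * (xu - x) + (y - yl) * (yu - y)
    + ((xu - xl) * (yu - yl) / 2 + - (yu - yl) / 2 * (x - xl) + - (xu - xl) / 2 * (y - yl)
       + 1 * (x - xl) * (y - yl))" for x y
    unfolding minus_gap_eq by (simp add: half_gap_def secant_gap_def field_simps)
  have nonneg: "0 \<le> (x * y + half_gap x y) - (x * y - minus_gap x y)"
    if "x \<in> {xl..xu}" "y \<in> {yl..yu}" for x y
    using gaps_nonneg[OF that] by linarith
  show ?thesis
    unfolding measure_hybs_lim unfolding bin3_lim_def
    using x_less y_less continuous_gaps nonneg
    by (subst measure_slab_quadratic[OF _ _ _ _ h]) (simp_all add: h, simp add: power2_eq_square field_simps)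
qed

end

theorem proposition13:
  fixes xl xu yl yu :: real
  assumes "xl < xu" and "yl < yu"
  shows "\<exists>H B2 B3.
     hausdorff_limit (hybs_lp_proj xl xu yl yu) H \<and>
     hausdorff_limit (bin2_lp_proj xl xu yl yu) B2 \<and>
     hausdorff_limit (bin3_lp_proj xl xu yl yu) B3 \<and>
     H \<subset> B2 \<and> H \<subset> B3 \<and>
     measure lborel B2 - measure lborel H = 1 / 4 * (xu - xl)\<^sup>2 * (yu - yl)\<^sup>2 \<and>
     measure lborel B3 - measure lborel H = 1 / 4 * (xu - xl)\<^sup>2 * (yu - yl)\<^sup>2"
proof -
  let ?H = "hybs_lim xl xu yl yu" and ?B2 = "bin2_lim xl xu yl yu" and ?B3 = "bin3_lim xl xu yl yu"
  \<comment> \<open>Strictness of the inclusions is read off from the volumes, which differ by a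
    positive amount.\<close>
  have "0 < 1 / 4 * (xu - xl)\<^sup>2 * (yu - yl)\<^sup>2" using assms by simp
  then have "?H \<noteq> ?B2" "?H \<noteq> ?B3"
    using measure_bin2_lim[OF assms] measure_bin3_lim[OF assms] by (metis add_cancel_left_right less_irrefl)+
  then have "?H \<subset> ?B2" "?H \<subset> ?B3"
    using hybs_lim_subset[OF assms] by blast+
  then show ?thesis
    using hausdorff_limit_hybs[OF assms] hausdorff_limit_bin2[OF assms] hausdorff_limit_bin3[OF assms]
      measure_bin2_lim[OF assms] measure_bin3_lim[OF assms]
    by (intro exI[of _ ?H] exI[of _ ?B2] exI[of _ ?B3]) simp
qed

end
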